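(* Let $M$ be a compact connected manifold of dimension greater than zero and let $F:M\multimap M$ be a continuous positively expansive set-valued map with $F(x)$ closed for all $x\in M$. Let $C(M)$ be the family of (nonempty) compact subsets of $M$ with the Hausdorff distance, and let $$\mathcal{D}(M)=\{K\in C(M): \exists\, x\in M \text{ and } \exists\, n\in\mathbb{Z} \text{ such that } F^n(x)=K\}.$$ If $\mathcal{D}(M)$ is closed in $C(M)$, then $h_{top}(F)>0$.
   Context: $M$ carries a distance $\mathrm{dist}$ inducing its topology. A set-valued map $F:M\multimap M$ assigns to every $x\in M$ a nonempty closed subset $F(x)\subset M$. For $A\subset M$ put $F(A)=\bigcup_{x\in A}F(x)$ and $F^{-1}(A)=\{x\in M: F(x)\cap A\neq\emptyset\}$; $F^0(A)=A$, and $F^n$, $F^{-n}=(F^{-1})^n$ ($n\ge 1$) are the corresponding iterates; $F^n(x)=F^n(\{x\})$. $F$ is continuous if for every open $U\subset M$ both $\{x: F(x)\subset U\}$ and $\{x:F(x)\cap U\ne\emptyset\}$ are open. $\mathrm{dist}_H$ denotes the Hausdorff distance between compact subsets of $M$. Positively expansive: a continuous and surjective set-valued map $F:M\multimap M$ with $F(x)$ closed for all $x$ is positively expansive if there is $\alpha>0$ such that if $x,y\in M$, $x\neq y$, then either $\mathrm{dist}_H(F^n(x),F^n(y))>\alpha$ for some $n\in\mathbb{N}$, or $F^n(x)=F^n(y)$ for every $n\ge 1$. Topological entropy: consider orbit segments $(x_1,\dots,x_n)$ with $x_{j+1}\in F(x_j)$ for $1\le j<n$. A set $A$ of such segments is $(n,\epsilon)$-separated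 if for any two distinct $(x_1,\dots,x_n),(y_1,\dots,y_n)\in A$ one has $\mathrm{dist}(x_i,y_i)>\epsilon$ for at least one $i\in\{1,\dots,n\}$. Let $s_n(\epsilon)$ be the greatest cardinality of an $(n,\epsilon)$-separated set. Then $h_{top}(F)=\lim_{\epsilon\to 0}\limsup_{n\to\infty}\frac1n\log s_n(\epsilon)$. *)

theory Defs
  imports "HOL-Analysis.Analysis"
begin

section \<open>Topological manifolds\<close>

text \<open>Manifolds are without boundary; no smooth structure is assumed.\<close>

definition topological_manifold :: "nat \<Rightarrow> 'a topology \<Rightarrow> bool" where
  "topological_manifold d X \<longleftrightarrow>
     Hausdorff_space X \<and> second_countable X \<and>
     (\<forall>x \<in> topspace X. \<exists>U V. openin X U \<and> x \<in> U \<and> openin (Euclidean_space d) V \<and>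
        subtopology X U homeomorphic_space subtopology (Euclidean_space d) V)"

section \<open>Set-valued maps\<close>

definition set_valued_map :: "('a::topological_space \<Rightarrow> 'a set) \<Rightarrow> bool" where
  "set_valued_map F \<longleftrightarrow> (\<forall>x. F x \<noteq> {} \<and> closed (F x))"

definition sv_image :: "('a \<Rightarrow> 'a set) \<Rightarrow> 'a set \<Rightarrow> 'a set" where
  "sv_image F A = (\<Union>x\<in>A. F x)"

definition sv_preimage :: "('a \<Rightarrow> 'a set) \<Rightarrow> 'a set \<Rightarrow> 'a set" where
  "sv_preimage F A = {x. F x \<inter> A \<noteq> {}}"

definition sv_iter :: "('a \<Rightarrow> 'a set) \<Rightarrow> int \<Rightarrow> 'a set \<Rightarrow> 'a set" where
  "sv_iter F n A =
     (if 0 \<le> n then (sv_image F ^^ nat n) A else (sv_preimage F ^^ nat (- n)) A)"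

definition sv_continuous :: "('a::topological_space \<Rightarrow> 'a set) \<Rightarrow> bool" where
  "sv_continuous F \<longleftrightarrow>
     (\<forall>U. open U \<longrightarrow> open {x. F x \<subseteq> U} \<and> open {x. F x \<inter> U \<noteq> {}})"

definition sv_surjective :: "('a \<Rightarrow> 'a set) \<Rightarrow> bool" where
  "sv_surjective F \<longleftrightarrow> sv_image F UNIV = UNIV"

section \<open>Hausdorff distance and the hyperspace of compact sets\<close>

text \<open>The value 0 outside nonempty bounded sets makes the function nonnegative everywhere, as
  \<^locale>\<open>Metric_space\<close> demands.\<close>

definition hausdorff_dist :: "'a::metric_space set \<Rightarrow> 'a set \<Rightarrow> real" where
  "hausdorff_dist A B =
     (if A \<noteq> {} \<and> B \<noteq> {} \<and> bounded A \<and> bounded B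
      then max (SUP a\<in>A. infdist a B) (SUP b\<in>B. infdist b A) else 0)"

definition nonempty_compacts :: "'a::metric_space set set" where
  "nonempty_compacts = {K. compact K \<and> K \<noteq> {}}"

definition hyperspace :: "'a::metric_space set topology" where
  "hyperspace = Metric_space.mtopology nonempty_compacts hausdorff_dist"

lemma hausdorff_dist_commute: "hausdorff_dist A B = hausdorff_dist B A"
  by (auto simp: hausdorff_dist_def max.commute)

lemma infdist_le_hausdorff_dist:
  assumes "A \<noteq> {}" "B \<noteq> {}" "bounded A" "bounded B" "a \<in> A"
  shows "infdist a B \<le> hausdorff_dist A B"
proof -
  obtain b where b: "b \<in> B" using assms by auto
  obtain e where e: "\<And>x. x \<in> A \<Longrightarrow> dist b x \<le> e"
    using \<open>bounded A\<close> bounded_any_center by metis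
  have "bdd_above ((\<lambda>a. infdist a B) ` A)"
    using e b by (intro bdd_aboveI2[where M = e]) (metis dist_commute infdist_le2)
  then have "infdist a B \<le> (SUP a\<in>A. infdist a B)"
    using assms by (intro cSUP_upper)
  then show ?thesis
    using assms by (simp add: hausdorff_dist_def)
qed

lemma hausdorff_dist_le:
  assumes "A \<noteq> {}" "B \<noteq> {}" "bounded A" "bounded B"
    and "\<And>a. a \<in> A \<Longrightarrow> infdist a B \<le> c" "\<And>b. b \<in> B \<Longrightarrow> infdist b A \<le> c"
  shows "hausdorff_dist A B \<le> c"
  using assms by (auto simp: hausdorff_dist_def intro!: cSUP_least)

lemma hausdorff_dist_nonneg: "0 \<le> hausdorff_dist A B"
proof (cases "A \<noteq> {} \<and> B \<noteq> {} \<and> bounded A \<and> bounded B")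
  case True
  then obtain a where "a \<in> A" by auto
  then show ?thesis
    using infdist_le_hausdorff_dist[of A B a] infdist_nonneg[of a B] True by linarith
qed (auto simp: hausdorff_dist_def)

lemma infdist_triangle_hausdorff_dist:
  assumes "B \<noteq> {}" "C \<noteq> {}" "bounded B" "bounded C"
  shows "infdist a C \<le> infdist a B + hausdorff_dist B C"
proof -
  have "infdist a C - hausdorff_dist B C \<le> dist a b" if "b \<in> B" for b
    using infdist_le_hausdorff_dist[OF assms that] infdist_triangle[of a C b] by linarith
  then have "infdist a C - hausdorff_dist B C \<le> infdist a B"
    using assms(1) by (simp add: infdist_notempty cINF_greatest)
  then show ?thesis by simp
qed

interpretation hyperspace:
  Metric_space "nonempty_compacts :: 'a::metric_space set set" hausdorff_dist
  rewrites "Metric_space.mtopology (nonempty_compacts :: 'a set set) hausdorff_dist = hyperspace"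
proof -
  show "Metric_space (nonempty_compacts :: 'a set set) hausdorff_dist"
  proof
    fix A B :: "'a set"
    show "0 \<le> hausdorff_dist A B"
      by (rule hausdorff_dist_nonneg)
    show "hausdorff_dist A B = hausdorff_dist B A"
      by (rule hausdorff_dist_commute)
    assume AB: "A \<in> nonempty_compacts" "B \<in> nonempty_compacts"
    then have *: "A \<noteq> {}" "B \<noteq> {}" "compact A" "compact B" "bounded A" "bounded B"
        "closed A" "closed B"
      by (auto simp: nonempty_compacts_def compact_imp_bounded compact_imp_closed)
    show "hausdorff_dist A B = 0 \<longleftrightarrow> A = B"
    proof
      assume 0: "hausdorff_dist A B = 0"
      have "a \<in> B" if "a \<in> A" for a
        using infdist_le_hausdorff_dist[of A B a] that * 0 infdist_nonneg[of a B]
        by (simp add: in_closed_iff_infdist_zero)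
      moreover have "b \<in> A" if "b \<in> B" for b
        using infdist_le_hausdorff_dist[of B A b] that * 0 infdist_nonneg[of b A]
        by (simp add: in_closed_iff_infdist_zero hausdorff_dist_commute)
      ultimately show "A = B" by blast
    next
      assume "A = B"
      then show "hausdorff_dist A B = 0"
        using * hausdorff_dist_nonneg[of A B] by (intro antisym hausdorff_dist_le) auto
    qed
    fix C :: "'a set"
    assume "C \<in> nonempty_compacts"
    then have C: "C \<noteq> {}" "compact C" "bounded C"
      by (auto simp: nonempty_compacts_def compact_imp_bounded)
    show "hausdorff_dist A C \<le> hausdorff_dist A B + hausdorff_dist B C"
    proof (rule hausdorff_dist_le)
      fix a assume "a \<in> A"
      then show "infdist a C \<le> hausdorff_dist A B + hausdorff_dist B C"
        using infdist_le_hausdorff_dist[of A B a] infdist_triangle_hausdorff_dist[of B C a] * C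
        by linarith
    next
      fix c assume "c \<in> C"
      then show "infdist c A \<le> hausdorff_dist A B + hausdorff_dist B C"
        using infdist_le_hausdorff_dist[of C B c] infdist_triangle_hausdorff_dist[of B A c] * C
        by (simp add: hausdorff_dist_commute)
    qed (use * C in auto)
  qed
qed (simp add: hyperspace_def)

section \<open>Expansiveness and entropy\<close>

text \<open>Separation at time \<open>n = 0\<close>, i.e. \<open>dist x y > \<alpha>\<close>, is allowed.\<close>

definition positively_expansive :: "('a::metric_space \<Rightarrow> 'a set) \<Rightarrow> bool" where
  "positively_expansive F \<longleftrightarrow>
     set_valued_map F \<and> sv_continuous F \<and> sv_surjective F \<and>
     (\<exists>\<alpha>>0. \<forall>x y. x \<noteq> y \<longrightarrow>
        (\<exists>n::nat. hausdorff_dist (sv_iter F (int n) {x}) (sv_iter F (int n) {y}) > \<alpha>) \<or>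
        (\<forall>n::nat. n \<ge> 1 \<longrightarrow> sv_iter F (int n) {x} = sv_iter F (int n) {y}))"

definition iterate_family :: "('a::metric_space \<Rightarrow> 'a set) \<Rightarrow> 'a set set" where
  "iterate_family F = {K \<in> nonempty_compacts. \<exists>x. \<exists>n::int. sv_iter F n {x} = K}"

definition orbit_segments :: "('a \<Rightarrow> 'a set) \<Rightarrow> nat \<Rightarrow> 'a list set" where
  "orbit_segments F n =
     {xs. length xs = n \<and> (\<forall>j. Suc j < n \<longrightarrow> xs ! Suc j \<in> F (xs ! j))}"

definition separated :: "('a::metric_space \<Rightarrow> 'a set) \<Rightarrow> nat \<Rightarrow> real \<Rightarrow> 'a list set \<Rightarrow> bool" where
  "separated F n \<epsilon> A \<longleftrightarrow>
     A \<subseteq> orbit_segments F n \<and>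
     (\<forall>xs\<in>A. \<forall>ys\<in>A. xs \<noteq> ys \<longrightarrow> (\<exists>i<n. dist (xs ! i) (ys ! i) > \<epsilon>))"

definition max_separated :: "('a::metric_space \<Rightarrow> 'a set) \<Rightarrow> nat \<Rightarrow> real \<Rightarrow> nat" where
  "max_separated F n \<epsilon> = (GREATEST k. \<exists>A. separated F n \<epsilon> A \<and> finite A \<and> card A = k)"

definition top_entropy :: "('a::metric_space \<Rightarrow> 'a set) \<Rightarrow> ereal" where
  "top_entropy F =
     Lim (at_right 0)
       (\<lambda>\<epsilon>. limsup (\<lambda>n. ereal (ln (real (max_separated F n \<epsilon>)) / real n)))"

text \<open>On a compact space the greatest cardinality and the limit exist.\<close>

lemma separated_bounded:
  fixes F :: "'a::metric_space \<Rightarrow> 'a set"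
  assumes "compact (UNIV :: 'a set)" "0 < \<epsilon>"
  shows "\<exists>N. \<forall>A. separated F n \<epsilon> A \<longrightarrow> finite A \<and> card A \<le> N"
proof -
  have "0 < \<epsilon>/2" using assms(2) by simp
  then obtain C :: "'a set" where C: "finite C" "UNIV \<subseteq> (\<Union>c\<in>C. ball c (\<epsilon>/2))"
    using assms(1) unfolding compact_eq_totally_bounded by blast
  then have "\<forall>x. \<exists>c\<in>C. dist c x < \<epsilon>/2" by (meson UN_E UNIV_I mem_ball subsetD)
  then obtain p where p: "\<And>x. p x \<in> C" "\<And>x. dist (p x) x < \<epsilon>/2" by metis
  define L where "L = {xs. set xs \<subseteq> C \<and> length xs = n}"
  have L: "finite L" unfolding L_def by (rule finite_lists_length_eq) fact
  have "finite A \<and> card A \<le> card L" if A: "separated F n \<epsilon> A" for A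
  proof -
    have len: "length xs = n" if "xs \<in> A" for xs
      using A that by (auto simp: separated_def orbit_segments_def)
    have "inj_on (map p) A"
    proof (rule inj_onI, rule ccontr)
      fix xs ys assume xy: "xs \<in> A" "ys \<in> A" "map p xs = map p ys" "xs \<noteq> ys"
      then obtain i where i: "i < n" "dist (xs ! i) (ys ! i) > \<epsilon>"
        using A unfolding separated_def by blast
      have "p (xs ! i) = p (ys ! i)"
        using xy i len by (metis nth_map)
      then show False
        using i p(2)[of "xs ! i"] p(2)[of "ys ! i"] dist_triangle2[of "xs ! i" "ys ! i" "p (xs ! i)"]
        by (simp add: dist_commute)
    qed
    moreover have "map p ` A \<subseteq> L"
      using len p(1) by (auto simp: L_def)
    ultimately show ?thesis
      using L by (meson card_inj_on_le finite_imageD finite_subset)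
  qed
  then show ?thesis by blast
qed

lemma max_separated:
  fixes F :: "'a::metric_space \<Rightarrow> 'a set"
  assumes "compact (UNIV :: 'a set)" "0 < \<epsilon>"
  shows "\<exists>A. separated F n \<epsilon> A \<and> finite A \<and> card A = max_separated F n \<epsilon>"
    and "separated F n \<epsilon> A \<Longrightarrow> card A \<le> max_separated F n \<epsilon>"
proof -
  obtain N where N: "\<And>A. separated F n \<epsilon> A \<Longrightarrow> finite A \<and> card A \<le> N"
    using separated_bounded[OF assms] by blast
  have "\<exists>A. separated F n \<epsilon> A \<and> finite A \<and> card A = 0"
    by (intro exI[of _ "{}"]) (auto simp: separated_def)
  then show "\<exists>A. separated F n \<epsilon> A \<and> finite A \<and> card A = max_separated F n \<epsilon>"
    unfolding max_separated_def using N by (rule_tac GreatestI_nat[where b = N]) auto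
  show "card A \<le> max_separated F n \<epsilon>" if "separated F n \<epsilon> A"
    unfolding max_separated_def using N that by (intro Greatest_le_nat[where b = N]) auto
qed

lemma max_separated_antimono:
  fixes F :: "'a::metric_space \<Rightarrow> 'a set"
  assumes "compact (UNIV :: 'a set)" "0 < \<delta>" "\<delta> \<le> \<epsilon>"
  shows "max_separated F n \<epsilon> \<le> max_separated F n \<delta>"
proof -
  obtain A where A: "separated F n \<epsilon> A" "card A = max_separated F n \<epsilon>"
    using max_separated(1)[of \<epsilon> F n] assms by auto
  then have "separated F n \<delta> A"
    using assms unfolding separated_def by (meson le_less_trans)
  then show ?thesis
    using max_separated(2)[of \<delta> F n A] assms A by simp
qed

lemma top_entropy_tendsto:
  fixes F :: "'a::metric_space \<Rightarrow> 'a set"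
  assumes "compact (UNIV :: 'a set)"
  shows "((\<lambda>\<epsilon>. limsup (\<lambda>n. ereal (ln (real (max_separated F n \<epsilon>)) / real n)))
           \<longlongrightarrow> top_entropy F) (at_right 0)"
proof -
  define h where "h = (\<lambda>\<epsilon>. limsup (\<lambda>n. ereal (ln (real (max_separated F n \<epsilon>)) / real n)))"
  have ln_mono: "ln (real a) \<le> ln (real b)" if "a \<le> b" for a b :: nat
    using that by (cases "a = 0"; cases "b = 0") auto
  have mono: "h \<epsilon> \<le> h \<delta>" if "0 < \<delta>" "\<delta> \<le> \<epsilon>" for \<delta> \<epsilon>
    unfolding h_def
    by (intro Limsup_mono always_eventually allI)
      (use that in \<open>auto intro!: divide_right_mono ln_mono max_separated_antimono[OF assms]\<close>)
  have "(h \<longlongrightarrow> (SUP \<epsilon>\<in>{0<..}. h \<epsilon>)) (at_right 0)"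
  proof (rule order_tendstoI)
    fix a assume "a < (SUP \<epsilon>\<in>{0<..}. h \<epsilon>)"
    then obtain \<epsilon> where \<epsilon>: "0 < \<epsilon>" "a < h \<epsilon>" by (auto simp: less_SUP_iff)
    show "\<forall>\<^sub>F \<delta> in at_right 0. a < h \<delta>"
      using eventually_at_right_real[OF \<epsilon>(1)]
    proof eventually_elim
      case (elim \<delta>)
      then show ?case using \<epsilon>(2) mono[of \<delta> \<epsilon>] by (auto intro: less_le_trans)
    qed
  next
    fix a assume a: "(SUP \<epsilon>\<in>{0<..}. h \<epsilon>) < a"
    show "\<forall>\<^sub>F \<delta> in at_right 0. h \<delta> < a"
      using eventually_at_right_less[of 0]
      by eventually_elim (use a in \<open>meson SUP_upper greaterThan_iff le_less_trans\<close>)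
  qed
  then show ?thesis
    unfolding top_entropy_def h_def[symmetric] by (metis tendsto_Lim trivial_limit_at_right_real)
qed

end

theory Submission
  imports Defs
begin

text \<open>
  Write \<open>\<rho> x y\<close> for the Hausdorff distance of \<open>F x\<close> and \<open>F y\<close>.  Positive entropy comes from a
  horseshoe of continua: there are \<open>\<epsilon>\<close> and \<open>N\<close> such that every continuum \<open>K\<close> that is stretched, in
  the sense of having \<open>\<rho>\<close>-diameter at least a fixed \<open>\<delta>\<close>, has two stretched continua, more than \<open>\<epsilon>\<close>
  apart, inside a common image \<open>F\<^sup>m(K)\<close> with \<open>m \<le> N\<close>.  Iterating this \<open>k\<close> times produces \<open>2\<^sup>k\<close>
  separated orbit segments of length \<open>k N + 1\<close> (\<open>top_entropy_pos_if_doubling\<close>).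

  Measuring continua by \<open>\<rho>\<close> rather than by their diameter is what makes the argument work for maps
  that collapse continua, that is, are constant on them.  If \<open>F x \<noteq> F y\<close>, and the
  distance of \<open>x\<close> and \<open>y\<close> is at most the expansivity constant \<open>\<alpha>\<close>, then \<open>F\<^sup>n x\<close> and \<open>F\<^sup>n y\<close> have
  Hausdorff distance more than \<open>\<alpha>\<close> for some \<open>n \<ge> 1\<close>; say that \<open>F\<^sup>n x\<close> contains a point more than
  \<open>\<alpha>\<close> away from all of \<open>F\<^sup>n y\<close>.  One step earlier, a point \<open>w\<close> of \<open>F\<^sup>n\<^sup>-\<^sup>1 x\<close> has an image containing
  this point, hence \<open>\<rho> w w' > \<alpha>\<close> for \<^emph>\<open>every\<close> \<open>w'\<close> in
  \<open>F\<^sup>n\<^sup>-\<^sup>1 y\<close>.  The projection of the graph of a continuous set-valued map is open, and therefore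
  components of the graph over a continuum \<open>K\<close> project onto \<open>K\<close> (\<open>continuum_lifting\<close>); so if \<open>x\<close>
  and \<open>y\<close> lie in \<open>K\<close>, some continuum in \<open>F\<^sup>n\<^sup>-\<^sup>1(K)\<close> contains \<open>w\<close> together with such a \<open>w'\<close>
  (\<open>continuum_of_large_image_spread\<close>).  Boundary bumping cuts two stretched continua out of it, one
  near \<open>w\<close> and one near \<open>w'\<close> (\<open>two_stretched_pieces\<close>).

  The time \<open>n\<close> is bounded uniformly over all stretched \<open>K\<close> because, by a pigeonhole argument along
  \<open>K\<close>, every stretched \<open>K\<close> contains points \<open>x, y\<close> which are close in distance but whose \<open>\<rho> x y\<close> is
  bounded below (\<open>close_pair_in_connected\<close>), and pairs of this kind form a compact set
  (\<open>uniform_separation_time\<close>).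

  The whole space is stretched for small \<open>\<delta>\<close> unless \<open>F\<close> is constant.  A constant surjective map has
  the value \<open>UNIV\<close>, so that all sequences are orbits; as a manifold of positive dimension has two
  points, the entropy is positive in this case too.
\<close>

section \<open>Continua\<close>

text \<open>In a compact Hausdorff space components are quasi-components, so a component disjoint from a
  closed set can be separated from it by a partition into two closed sets.\<close>

lemma continuum_or_separation:
  fixes S T :: "'a::metric_space set"
  assumes S: "compact S" and x: "x \<in> S" and T: "closed T"
  obtains C where "compact C" "connected C" "x \<in> C" "C \<subseteq> S" "C \<inter> T \<noteq> {}"
  | U V where "closed U" "closed V" "U \<union> V = S" "U \<inter> V = {}" "x \<in> U" "S \<inter> T \<subseteq> V"
proof -
  let ?X = "top_of_set S"
  define C where "C = connected_component_of_set ?X x"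
  have cs: "compact_space ?X" "Hausdorff_space ?X"
    using S by (simp_all add: compact_space_subtopology Hausdorff_space_subtopology)
  have C: "C \<in> connected_components_of ?X"
    unfolding C_def using x by (simp add: connected_component_in_connected_components_of)
  have xC: "x \<in> C"
    using x by (simp add: C_def connected_component_of_refl)
  have C': "connected C" "C \<subseteq> S"
    using connectedin_connected_components_of[OF C] by (auto simp: connectedin_subtopology)
  have cC: "compactin ?X C"
    by (rule closedin_compact_space[OF cs(1) closedin_connected_components_of[OF C]])
  then have C'': "compact C"
    by (simp add: compactin_subtopology)
  show thesis
  proof (cases "C \<inter> T = {}")
    case True
    have "separated_between ?X C (S \<inter> T)"
      by (rule separated_between_compact_connected_component)
        (use cs C cC T True in \<open>auto simp: compact_imp_locally_compact_space disjnt_def closedin_closed_Int\<close>)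
    then obtain U V where "closedin ?X U" "closedin ?X V" "U \<union> V = S" "disjnt U V" "C \<subseteq> U" "S \<inter> T \<subseteq> V"
      unfolding separated_between_alt by auto
    then show thesis
      using that(2)[of U V] xC compact_imp_closed[OF S] by (auto simp: disjnt_def intro: closedin_closed_trans)
  qed (use that(1) C' C'' xC in blast)
qed

text \<open>The component of \<open>a\<close> in the sublevel set has to reach the level \<open>c\<close>: otherwise
  a clopen part of the sublevel set around \<open>a\<close> that avoids the level would be clopen in all of \<open>K\<close>.\<close>

lemma boundary_bumping_level:
  fixes g :: "'a::metric_space \<Rightarrow> real"
  assumes K: "compact K" "connected K" and g: "continuous_on UNIV g"
    and ab: "a \<in> K" "b \<in> K" "g a \<le> c" "c \<le> g b"
  obtains C z where "compact C" "connected C" "a \<in> C" "C \<subseteq> K" "\<And>x. x \<in> C \<Longrightarrow> g x \<le> c" "z \<in> C" "g z = c"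
proof -
  have cl: "closed {z. g z \<le> c}" "closed {z. c \<le> g z}"
    using g by (auto intro!: closed_Collect_le)
  have "compact (K \<inter> {z. g z \<le> c})" "a \<in> K \<inter> {z. g z \<le> c}"
    using K cl ab by (auto intro: compact_Int_closed)
  from continuum_or_separation[OF this cl(2)] show thesis
  proof cases
    case (1 C)
    then obtain z where "z \<in> C" "c \<le> g z" by blast
    moreover have *: "C \<subseteq> K" "\<And>x. x \<in> C \<Longrightarrow> g x \<le> c" using 1(4) by blast+
    ultimately show thesis
      using that[of C z, OF 1(1,2,3) *(1) *(2)] by (simp add: order_antisym)
  next
    case (2 U V)
    \<comment> \<open>Points of \<open>K\<close> outside the sublevel set are added to the part that contains the level,
      which turns the partition of the sublevel set into one of \<open>K\<close>.\<close>
    let ?V = "V \<union> {z. c \<le> g z}"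
    have UK: "U \<subseteq> K \<inter> {z. g z \<le> c}" using 2(3) by blast
    have "closed ?V" using 2(2) cl(2) by (rule closed_Un)
    moreover have "U \<inter> ?V \<inter> K = {}" using UK 2(4,6) by blast
    moreover have "z \<in> U \<union> ?V" if "z \<in> K" for z
      using that 2(3) by (cases "g z \<le> c") auto
    then have "K \<subseteq> U \<union> ?V" by blast
    moreover have "U \<inter> K \<noteq> {}" "?V \<inter> K \<noteq> {}" using 2(5) ab by blast+
    ultimately have False
      using K(2) 2(1) unfolding connected_closed by blast
    then show thesis ..
  qed
qed

text \<open>A set-valued map need not have continuous selections, but connectedness can still be transported:
  the continuum \<open>L\<close> is the second projection of the component of \<open>(x, w)\<close> in the graph over \<open>K\<close>.
  The graph projects onto \<open>K\<close> by an open map (lower semicontinuity of \<open>G\<close>), so the projection of a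
  clopen part of the graph is clopen, hence all of \<open>K\<close>.  Thus no part of the graph around the
  component can miss the fibre over \<open>y\<close>.\<close>

lemma continuum_lifting:
  fixes G :: "'a::metric_space \<Rightarrow> 'a set"
  assumes G: "sv_continuous G" and graph: "compact {(t, w). t \<in> K \<and> w \<in> G t}"
    and K: "connected K" and x: "x \<in> K" "w \<in> G x" and y: "y \<in> K"
  obtains L w' where "compact L" "connected L" "L \<subseteq> sv_image G K" "w \<in> L" "w' \<in> L" "w' \<in> G y"
proof -
  let ?Q = "{(t, w). t \<in> K \<and> w \<in> G t}"
  have "(x, w) \<in> ?Q" "closed ({y} \<times> UNIV :: ('a \<times> 'a) set)"
    using x by (auto intro: closed_Times)
  from continuum_or_separation[OF graph this] show thesis
  proof cases
    case (1 C)
    have "continuous_on C snd" by (intro continuous_intros)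
    then have "compact (snd ` C)" "connected (snd ` C)"
      using 1 by (auto intro: compact_continuous_image connected_continuous_image)
    moreover have "snd ` C \<subseteq> sv_image G K" using 1(4) by (force simp: sv_image_def)
    moreover obtain w' where "(y, w') \<in> C" using 1(5) by auto
    moreover from this have "w' \<in> G y" using 1(4) by auto
    moreover have "w \<in> snd ` C" "w' \<in> snd ` C"
      using 1(3) \<open>(y, w') \<in> C\<close> by (metis image_eqI snd_conv)+
    ultimately show thesis by (intro that)
  next
    case (2 U V)
    define W where "W = fst ` U"
    have W: "s \<in> W \<longleftrightarrow> (\<exists>r. (s, r) \<in> U)" for s
      unfolding W_def by force
    have Q: "s \<in> K \<and> r \<in> G s" if "(s, r) \<in> U" for s r
      using that 2(3) by blast
    have "compact U"
      using compact_Int_closed[OF graph 2(1)] unfolding 2(3)[symmetric] by (simp only: Int_absorb1 Un_upper1)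
    then have "compact W"
      unfolding W_def by (intro compact_continuous_image continuous_intros)
    then have "closedin (top_of_set K) W"
      using Q by (intro closed_subset compact_imp_closed) (auto simp: W)
    moreover have "openin (top_of_set K) W"
    proof (subst openin_subopen, intro ballI)
      fix t assume "t \<in> W"
      then obtain v where tv: "(t, v) \<in> U" by (auto simp: W)
      then have "open (- V)" "(t, v) \<in> - V" using 2(2,4) by auto
      then obtain A B where AB: "open A" "open B" "(t, v) \<in> A \<times> B" "A \<times> B \<subseteq> - V"
        by (rule open_prod_elim)
      let ?O = "A \<inter> {s. G s \<inter> B \<noteq> {}}"
      have "open ?O" using G AB by (auto simp: sv_continuous_def)
      then have "openin (top_of_set K) (K \<inter> ?O)" by (rule openin_open_Int)
      moreover have "t \<in> K \<inter> ?O" using Q[OF tv] AB(3) by auto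
      moreover have "K \<inter> ?O \<subseteq> W"
      proof
        fix s assume "s \<in> K \<inter> ?O"
        then obtain r where r: "s \<in> K" "s \<in> A" "r \<in> G s" "r \<in> B" by auto
        then have "(s, r) \<in> U \<union> V" "(s, r) \<notin> V" unfolding 2(3) using AB(4) by auto
        then show "s \<in> W" by (auto simp: W)
      qed
      ultimately show "\<exists>T. openin (top_of_set K) T \<and> t \<in> T \<and> T \<subseteq> W" by blast
    qed
    ultimately have "W = {} \<or> W = K"
      using K by (metis connected_clopen)
    moreover have "x \<in> W" using 2(5) by (auto simp: W)
    moreover have "y \<notin> W"
    proof
      assume "y \<in> W"
      then obtain r where "(y, r) \<in> U" by (auto simp: W)
      then have "(y, r) \<in> V" using 2(6) Q by auto
      then show False using \<open>(y, r) \<in> U\<close> 2(4) by blast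
    qed
    ultimately show thesis using x y by auto
  qed
qed

section \<open>Continuity of iterates in the Hausdorff distance\<close>

lemma graph_closed:
  fixes F :: "'a::metric_space \<Rightarrow> 'a set"
  assumes F: "sv_continuous F" "set_valued_map F"
  shows "closed {(x, y). y \<in> F x}"
proof -
  have "open (- {(x, y). y \<in> F x})"
  proof (subst open_subopen, intro ballI)
    fix p assume "p \<in> - {(x, y). y \<in> F x}"
    then obtain x y where p: "p = (x, y)" "y \<notin> F x" by (cases p) auto
    define r where "r = infdist y (F x) / 2"
    have F1: "closed (F x)" "F x \<noteq> {}" using F by (auto simp: set_valued_map_def)
    have r: "0 < r"
      using in_closed_iff_infdist_zero[OF F1] p infdist_nonneg[of y "F x"] by (auto simp: r_def less_le)
    let ?A = "{x'. F x' \<subseteq> {z. infdist z (F x) < r}}"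
    have "open {z. infdist z (F x) < r}"
      by (intro open_Collect_less continuous_intros)
    then have "open ?A" using F by (auto simp: sv_continuous_def)
    moreover have "x \<in> ?A" using r by auto
    moreover have "b \<notin> F a" if "a \<in> ?A" "b \<in> ball y r" for a b
    proof
      assume "b \<in> F a"
      then have "infdist b (F x) < r" "dist y b < r" using that by auto
      then show False using infdist_triangle[of y "F x" b] by (simp add: r_def)
    qed
    then have "?A \<times> ball y r \<subseteq> - {(x, y). y \<in> F x}" by blast
    ultimately show "\<exists>T. open T \<and> p \<in> T \<and> T \<subseteq> - {(x, y). y \<in> F x}"
      using r p by (intro exI[of _ "?A \<times> ball y r"]) (auto intro: open_Times)
  qed
  then show ?thesis by (simp add: closed_def)
qed

lemma compact_sv_image:
  fixes F :: "'a::metric_space \<Rightarrow> 'a set"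
  assumes M: "compact (UNIV :: 'a set)" and F: "sv_continuous F" "set_valued_map F" and K: "compact K"
  shows "compact {(x, y). x \<in> K \<and> y \<in> F x}" "compact (sv_image F K)"
proof -
  have "compact ((K \<times> UNIV) \<inter> {(x, y). y \<in> F x})"
    using K M graph_closed[OF F] by (intro compact_Int_closed compact_Times)
  moreover have eq: "{(x, y). x \<in> K \<and> y \<in> F x} = (K \<times> UNIV) \<inter> {(x, y). y \<in> F x}" by auto
  ultimately show *: "compact {(x, y). x \<in> K \<and> y \<in> F x}" by simp
  have "sv_image F K = snd ` {(x, y). x \<in> K \<and> y \<in> F x}"
    by (force simp: sv_image_def)
  then show "compact (sv_image F K)"
    using compact_continuous_image[OF _ *, of snd] by (simp add: continuous_on_snd)
qed

lemma iterate_set_valued_continuous: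
  fixes F :: "'a::metric_space \<Rightarrow> 'a set"
  assumes M: "compact (UNIV :: 'a set)" and F: "sv_continuous F" "set_valued_map F"
  shows "sv_continuous (\<lambda>x. (sv_image F ^^ n) {x})" "set_valued_map (\<lambda>x. (sv_image F ^^ n) {x})"
proof -
  have "sv_continuous (\<lambda>x. (sv_image F ^^ n) {x}) \<and> (\<forall>x. (sv_image F ^^ n) {x} \<noteq> {} \<and> compact ((sv_image F ^^ n) {x}))"
  proof (induction n)
    case 0
    then show ?case by (simp add: sv_continuous_def)
  next
    case (Suc n)
    let ?G = "\<lambda>x. (sv_image F ^^ n) {x}"
    have G: "open {x. ?G x \<subseteq> U}" "open {x. ?G x \<inter> U \<noteq> {}}" if "open U" for U
      using Suc that by (auto simp: sv_continuous_def)
    have "open {x. sv_image F (?G x) \<subseteq> U}" "open {x. sv_image F (?G x) \<inter> U \<noteq> {}}" if "open U" for U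
    proof -
      have "open {y. F y \<subseteq> U}" "open {y. F y \<inter> U \<noteq> {}}" using F that by (auto simp: sv_continuous_def)
      then have "open {x. ?G x \<subseteq> {y. F y \<subseteq> U}}" "open {x. ?G x \<inter> {y. F y \<inter> U \<noteq> {}} \<noteq> {}}"
        using G by blast+
      moreover have "{x. sv_image F (?G x) \<subseteq> U} = {x. ?G x \<subseteq> {y. F y \<subseteq> U}}"
        "{x. sv_image F (?G x) \<inter> U \<noteq> {}} = {x. ?G x \<inter> {y. F y \<inter> U \<noteq> {}} \<noteq> {}}"
        by (auto simp: sv_image_def)
      ultimately show "open {x. sv_image F (?G x) \<subseteq> U}" "open {x. sv_image F (?G x) \<inter> U \<noteq> {}}"
        by simp_all
    qed
    moreover have "sv_image F (?G x) \<noteq> {}" for x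
      using Suc F unfolding sv_image_def[of F "?G x"] by (simp add: set_valued_map_def)
    ultimately show ?case
      using Suc compact_sv_image(2)[OF M F] by (auto simp: sv_continuous_def)
  qed
  then show "sv_continuous (\<lambda>x. (sv_image F ^^ n) {x})" "set_valued_map (\<lambda>x. (sv_image F ^^ n) {x})"
    by (auto simp: set_valued_map_def compact_imp_closed)
qed

lemma set_valued_map_nonempty_compacts:
  fixes G :: "'a::metric_space \<Rightarrow> 'a set"
  assumes "compact (UNIV :: 'a set)" "set_valued_map G"
  shows "G x \<in> nonempty_compacts"
  using assms compact_Int_closed[of UNIV "G x"] by (auto simp: set_valued_map_def nonempty_compacts_def)

text \<open>Upper semicontinuity keeps \<open>G y\<close> near \<open>G x\<close>; lower semicontinuity, applied to the balls of a
  finite cover of \<open>G x\<close>, keeps \<open>G x\<close> near \<open>G y\<close>.\<close>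

lemma eventually_hausdorff_dist_le:
  fixes G :: "'a::metric_space \<Rightarrow> 'a set"
  assumes M: "compact (UNIV :: 'a set)" and G: "sv_continuous G" "set_valued_map G" and e: "0 < e"
  shows "\<forall>\<^sub>F y in nhds x. hausdorff_dist (G y) (G x) \<le> e"
proof -
  have nc: "compact (G y)" "G y \<noteq> {}" "bounded (G y)" for y
    using set_valued_map_nonempty_compacts[OF M G(2), of y]
    by (auto simp: nonempty_compacts_def compact_imp_bounded)
  have "open {z. infdist z (G x) < e}"
    by (intro open_Collect_less continuous_intros)
  then have "open {y. G y \<subseteq> {z. infdist z (G x) < e}}"
    using G by (auto simp: sv_continuous_def)
  then have "\<forall>\<^sub>F y in nhds x. y \<in> {y. G y \<subseteq> {z. infdist z (G x) < e}}"
    using e by (intro eventually_nhds_in_open) auto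
  then have upper: "\<forall>\<^sub>F y in nhds x. G y \<subseteq> {z. infdist z (G x) < e}" by simp
  have "G x \<subseteq> (\<Union>c\<in>G x. ball c (e/2))" using e by force
  then obtain C where C: "C \<subseteq> G x" "finite C" "G x \<subseteq> (\<Union>c\<in>C. ball c (e/2))"
    using compactE_image[OF nc(1)[of x], of "G x" "\<lambda>c. ball c (e/2)"] open_ball by metis
  have "\<forall>\<^sub>F y in nhds x. \<forall>c\<in>C. G y \<inter> ball c (e/2) \<noteq> {}"
  proof (intro eventually_ball_finite C(2) ballI)
    fix c assume "c \<in> C"
    then have "c \<in> G x \<inter> ball c (e/2)" using C e by auto
    moreover have "open {y. G y \<inter> ball c (e/2) \<noteq> {}}"
      using G by (auto simp: sv_continuous_def)
    ultimately have "\<forall>\<^sub>F y in nhds x. y \<in> {y. G y \<inter> ball c (e/2) \<noteq> {}}"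
      by (intro eventually_nhds_in_open) auto
    then show "\<forall>\<^sub>F y in nhds x. G y \<inter> ball c (e/2) \<noteq> {}" by simp
  qed
  with upper show ?thesis
  proof eventually_elim
    case (elim y)
    show ?case
    proof (rule hausdorff_dist_le)
      fix b assume "b \<in> G x"
      then obtain c where c: "c \<in> C" "dist c b < e/2" using C by auto
      have "G y \<inter> ball c (e/2) \<noteq> {}" using elim(2) c(1) by blast
      then obtain z where "z \<in> G y" "dist c z < e/2" by auto
      then show "infdist b (G y) \<le> e"
        using c dist_triangle3[of b z c] by (intro infdist_le2[of z]) auto
    next
      fix a assume "a \<in> G y"
      then have "infdist a (G x) < e" using elim(1) by blast
      then show "infdist a (G x) \<le> e" by (rule less_imp_le)
    qed (rule nc)+
  qed
qed

lemma continuous_on_hausdorff_dist: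
  fixes G :: "'a::metric_space \<Rightarrow> 'a set"
  assumes M: "compact (UNIV :: 'a set)" and G: "sv_continuous G" "set_valued_map G"
  shows "continuous_on UNIV (\<lambda>p. hausdorff_dist (G (fst p)) (G (snd p)))"
proof -
  note nc = set_valued_map_nonempty_compacts[OF M G(2)]
  have tri: "hausdorff_dist (G a) (G c) \<le> hausdorff_dist (G a) (G b) + hausdorff_dist (G b) (G c)" for a b c
    by (rule hyperspace.triangle[OF nc nc nc])
  have "((\<lambda>p. hausdorff_dist (G (fst p)) (G (snd p))) \<longlongrightarrow> hausdorff_dist (G x) (G y)) (nhds (x, y))" for x y
  proof (rule tendstoI)
    fix e :: real assume "0 < e"
    then have e: "0 < e/3" by simp
    have lim: "filterlim fst (nhds x) (nhds (x, y))" "filterlim snd (nhds y) (nhds (x, y))"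
      using tendsto_fst[OF filterlim_ident, of "(x, y)"] tendsto_snd[OF filterlim_ident, of "(x, y)"] by simp_all
    have "\<forall>\<^sub>F p in nhds (x, y). hausdorff_dist (G (fst p)) (G x) \<le> e/3 \<and> hausdorff_dist (G (snd p)) (G y) \<le> e/3"
      by (intro eventually_conj eventually_compose_filterlim[OF eventually_hausdorff_dist_le[OF M G e] lim(1)]
          eventually_compose_filterlim[OF eventually_hausdorff_dist_le[OF M G e] lim(2)])
    then show "\<forall>\<^sub>F p in nhds (x, y). dist (hausdorff_dist (G (fst p)) (G (snd p))) (hausdorff_dist (G x) (G y)) < e"
    proof eventually_elim
      case (elim p)
      obtain u v where p: "p = (u, v)" by (cases p)
      show ?case
        using elim e tri[where a = u and b = x and c = v] tri[where a = x and b = y and c = v]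
          tri[where a = x and b = u and c = y] tri[where a = u and b = v and c = y]
          hausdorff_dist_commute[of "G u" "G x"] hausdorff_dist_commute[of "G v" "G y"]
        by (simp add: p dist_real_def abs_less_iff)
    qed
  qed
  then show ?thesis
    unfolding continuous_on_def by (auto intro: tendsto_mono[OF at_within_le_nhds])
qed

lemma sv_image_iterate: "sv_image (\<lambda>x. (sv_image F ^^ n) {x}) K = (sv_image F ^^ n) K"
proof (induction n)
  case 0
  then show ?case by (auto simp: sv_image_def)
next
  case (Suc n)
  have "sv_image (\<lambda>x. (sv_image F ^^ Suc n) {x}) K = sv_image F (sv_image (\<lambda>x. (sv_image F ^^ n) {x}) K)"
    by (auto simp add: sv_image_def[of F "(sv_image F ^^ n) _"] sv_image_def[of _ K] sv_image_def[of F "\<Union> _"])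
  then show ?case using Suc by simp
qed

section \<open>Entropy from doubling families of sets\<close>

lemma mem_orbit_segments:
  "xs \<in> orbit_segments F n \<longleftrightarrow> length xs = n \<and> successively (\<lambda>x y. y \<in> F x) xs"
  by (auto simp: orbit_segments_def successively_conv_nth)

lemma orbit_prefix:
  assumes "z \<in> (sv_image F ^^ m) K"
  obtains p where "length p = m" "successively (\<lambda>x y. y \<in> F x) (p @ [z])" "hd (p @ [z]) \<in> K"
  using assms
proof (induction m arbitrary: z thesis)
  case 0
  then show ?case by simp
next
  case (Suc m)
  then obtain y where y: "y \<in> (sv_image F ^^ m) K" "z \<in> F y"
    using sv_image_def[of F "(sv_image F ^^ m) K"] by auto
  with Suc.IH obtain p where "length p = m" "successively (\<lambda>x y. y \<in> F x) (p @ [y])" "hd (p @ [y]) \<in> K"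
    by blast
  then show ?case
    using y by (intro Suc.prems(1)[of "p @ [y]"]) (auto simp: successively_append_iff hd_append split: if_splits)
qed

lemma orbit_suffix:
  assumes "\<And>x. F x \<noteq> {}"
  obtains s where "length s = j" "successively (\<lambda>x y. y \<in> F x) (z # s)"
proof (induction j arbitrary: z thesis)
  case 0
  then show ?case by simp
next
  case (Suc j)
  obtain y where "y \<in> F z" using assms by auto
  moreover obtain s where "length s = j" "successively (\<lambda>x y. y \<in> F x) (y # s)" using Suc.IH by blast
  ultimately show ?case using Suc.prems[of "y # s"] by simp
qed

text \<open>By induction on \<open>k\<close>: segments starting in \<open>L1\<close> and in \<open>L2\<close> are separated at their first entry, so
  the two families that the induction hypothesis gives can be united.  Prefixing orbit segments of
  length \<open>m\<close> moves the starting points to \<open>K\<close>.  The number \<open>m\<close> depends on \<open>K\<close>; a suffix of length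
  \<open>N - m\<close> gives all segments the same length.\<close>

lemma separated_power_two:
  fixes F :: "'a::metric_space \<Rightarrow> 'a set"
  assumes ne: "\<And>x. F x \<noteq> {}" and eps: "0 < \<epsilon>" and good: "\<And>K. good K \<Longrightarrow> K \<noteq> {}"
    and doubling: "\<And>K. good K \<Longrightarrow> \<exists>m L1 L2. m \<le> N \<and> good L1 \<and> good L2 \<and>
        L1 \<subseteq> (sv_image F ^^ m) K \<and> L2 \<subseteq> (sv_image F ^^ m) K \<and> (\<forall>u\<in>L1. \<forall>v\<in>L2. \<epsilon> < dist u v)"
    and K: "good K"
  shows "\<exists>A. separated F (k * N + 1) \<epsilon> A \<and> finite A \<and> card A = 2 ^ k \<and> (\<forall>xs\<in>A. hd xs \<in> K)"
  using K
proof (induction k arbitrary: K)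
  case 0
  then obtain z where "z \<in> K" using good by blast
  then show ?case
    by (intro exI[of _ "{[z]}"]) (auto simp: separated_def mem_orbit_segments)
next
  case (Suc k)
  let ?n = "k * N + 1" and ?R = "\<lambda>x y. y \<in> F x"
  obtain m L1 L2 where m: "m \<le> N" and L: "good L1" "good L2"
      "L1 \<subseteq> (sv_image F ^^ m) K" "L2 \<subseteq> (sv_image F ^^ m) K" "\<And>u v. u \<in> L1 \<Longrightarrow> v \<in> L2 \<Longrightarrow> \<epsilon> < dist u v"
    using doubling[OF Suc.prems] by metis
  obtain A where A: "separated F ?n \<epsilon> A" "finite A" "card A = 2 ^ k" "\<And>xs. xs \<in> A \<Longrightarrow> hd xs \<in> L1"
    using Suc.IH[OF L(1)] by blast
  obtain B where B: "separated F ?n \<epsilon> B" "finite B" "card B = 2 ^ k" "\<And>xs. xs \<in> B \<Longrightarrow> hd xs \<in> L2"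
    using Suc.IH[OF L(2)] by blast
  have orb: "length xs = ?n" "successively ?R xs" "xs \<noteq> []" if "xs \<in> A \<union> B" for xs
    using that A(1) B(1) by (auto simp: separated_def mem_orbit_segments)
  have cross: "\<epsilon> < dist (xs ! 0) (ys ! 0)" if "xs \<in> A" "ys \<in> B" for xs ys
    using L(5)[OF A(4) B(4)] that orb(3)[of xs] orb(3)[of ys] by (simp flip: hd_conv_nth)
  have sep: "\<exists>i<?n. \<epsilon> < dist (xs ! i) (ys ! i)" if "xs \<in> A \<union> B" "ys \<in> A \<union> B" "xs \<noteq> ys" for xs ys
  proof -
    consider "xs \<in> A" "ys \<in> A" | "xs \<in> B" "ys \<in> B" | "xs \<in> A" "ys \<in> B" | "xs \<in> B" "ys \<in> A"
      using \<open>xs \<in> A \<union> B\<close> \<open>ys \<in> A \<union> B\<close> by blast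
    then show ?thesis
    proof cases
      case 1 then show ?thesis using A(1) \<open>xs \<noteq> ys\<close> by (auto simp: separated_def)
    next
      case 2 then show ?thesis using B(1) \<open>xs \<noteq> ys\<close> by (auto simp: separated_def)
    next
      case 3 then show ?thesis using cross by (intro exI[of _ 0]) simp
    next
      case 4 then show ?thesis using cross[of ys xs] by (intro exI[of _ 0]) (simp add: dist_commute)
    qed
  qed
  have "A \<inter> B = {}"
    using cross eps by (metis disjoint_iff dist_self less_asym)
  then have card: "card (A \<union> B) = 2 ^ Suc k"
    using A B by (simp add: card_Un_disjoint)
  have "\<exists>p s. length p = m \<and> length s = N - m \<and> successively ?R (p @ xs @ s) \<and> hd (p @ xs) \<in> K"
    if "xs \<in> A \<union> B" for xs
  proof -
    have "hd xs \<in> (sv_image F ^^ m) K" using that A(4) B(4) L by blast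
    then obtain p where p: "length p = m" "successively ?R (p @ [hd xs])" "hd (p @ [hd xs]) \<in> K"
      by (rule orbit_prefix)
    obtain s where s: "length s = N - m" "successively ?R (last xs # s)"
      using orbit_suffix[of F, OF ne] by blast
    have "hd (p @ xs) = hd (p @ [hd xs])"
      by (cases p) auto
    then show ?thesis
      using p s orb[OF that] by (intro exI[of _ p] exI[of _ s])
        (auto simp: successively_append_iff successively_Cons hd_append)
  qed
  then obtain p s where ps: "\<And>xs. xs \<in> A \<union> B \<Longrightarrow> length (p xs) = m \<and> length (s xs) = N - m \<and>
      successively ?R (p xs @ xs @ s xs) \<and> hd (p xs @ xs) \<in> K"
    by metis
  define f where "f xs = p xs @ xs @ s xs" for xs
  have nth: "f xs ! (m + i) = xs ! i" if "xs \<in> A \<union> B" "i < ?n" for xs i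
    using ps[OF that(1)] orb(1)[OF that(1)] that(2) by (simp add: f_def nth_append)
  have far: "\<exists>i < Suc k * N + 1. \<epsilon> < dist (f xs ! i) (f ys ! i)"
    if xy: "xs \<in> A \<union> B" "ys \<in> A \<union> B" "xs \<noteq> ys" for xs ys
  proof -
    obtain i where "i < ?n" "\<epsilon> < dist (xs ! i) (ys ! i)" using sep[OF xy] by blast
    then show ?thesis using nth xy m by (intro exI[of _ "m + i"]) auto
  qed
  have "inj_on f (A \<union> B)"
    using far eps by (intro inj_onI) (metis dist_self less_asym)
  then have "card (f ` (A \<union> B)) = 2 ^ Suc k" using card by (simp add: card_image)
  moreover have "f xs \<in> orbit_segments F (Suc k * N + 1)" if "xs \<in> A \<union> B" for xs
    using ps[OF that] orb[OF that] m by (simp add: f_def mem_orbit_segments)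
  then have "separated F (Suc k * N + 1) \<epsilon> (f ` (A \<union> B))"
    using far by (auto simp: separated_def)
  moreover have "hd (f xs) \<in> K" if "xs \<in> A \<union> B" for xs
    using ps[OF that] orb(3)[OF that] by (simp add: f_def hd_append split: if_splits)
  ultimately show ?case
    using A(2) B(2) by (intro exI[of _ "f ` (A \<union> B)"]) auto
qed

lemma top_entropy_pos_if_exponential:
  fixes F :: "'a::metric_space \<Rightarrow> 'a set"
  assumes M: "compact (UNIV :: 'a set)" and eps: "0 < \<epsilon>"
    and exp: "\<And>k. 2 ^ k \<le> max_separated F (k * N + 1) \<epsilon>"
  shows "0 < top_entropy F"
proof -
  define h where "h \<epsilon> = limsup (\<lambda>n. ereal (ln (real (max_separated F n \<epsilon>)) / real n))" for \<epsilon>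
  define c where "c = ln 2 / (real N + 1)"
  have "0 < c" by (simp add: c_def)
  have "0 < N"
  proof (rule ccontr)
    \<comment> \<open>Otherwise the separated sets of segments of length 1 would be arbitrarily large.\<close>
    assume "\<not> 0 < N"
    then have "2 ^ k \<le> max_separated F 1 \<epsilon>" for k using exp[of k] by simp
    moreover have "max_separated F 1 \<epsilon> < 2 ^ max_separated F 1 \<epsilon>" by simp
    ultimately show False using linorder_not_le by blast
  qed
  have "ereal c \<le> h \<delta>" if \<delta>: "0 < \<delta>" "\<delta> \<le> \<epsilon>" for \<delta>
  proof -
    let ?X = "\<lambda>n. ereal (ln (real (max_separated F n \<delta>)) / real n)" and ?r = "\<lambda>k. k * N + 1"
    have "c \<le> ln (real (max_separated F (k * N + 1) \<delta>)) / real (k * N + 1)" if "1 \<le> k" for k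
    proof -
      have "2 ^ k \<le> max_separated F (k * N + 1) \<delta>"
        using exp[of k] max_separated_antimono[OF M \<delta>] by (rule order_trans)
      then have "(2::real) ^ k \<le> real (max_separated F (k * N + 1) \<delta>)"
        by (metis of_nat_le_iff of_nat_numeral of_nat_power)
      then have "ln (2 ^ k) \<le> ln (real (max_separated F (k * N + 1) \<delta>))"
        by (intro ln_mono) (auto intro: less_le_trans)
      then have 1: "real k * ln 2 \<le> ln (real (max_separated F (k * N + 1) \<delta>))"
        by (simp add: ln_realpow)
      have "c * real (k * N + 1) \<le> c * (real k * (real N + 1))"
        using \<open>0 < c\<close> that by (intro mult_left_mono) (auto simp: algebra_simps)
      also have "\<dots> = real k * ln 2" by (simp add: c_def)
      finally have "c * real (k * N + 1) \<le> ln (real (max_separated F (k * N + 1) \<delta>))"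
        using 1 by linarith
      moreover have "0 < real (k * N + 1)" unfolding of_nat_0_less_iff by simp
      ultimately show ?thesis by (simp only: pos_le_divide_eq)
    qed
    then have "\<forall>\<^sub>F k in sequentially. ereal c \<le> (?X \<circ> ?r) k"
      by (auto intro!: eventually_sequentiallyI[of 1])
    then have "ereal c \<le> limsup (?X \<circ> ?r)" by (intro le_Limsup) auto
    also have "\<dots> \<le> limsup ?X"
      using \<open>0 < N\<close> by (intro limsup_subseq_mono) (auto simp: strict_mono_def)
    finally show ?thesis by (simp add: h_def)
  qed
  then have "\<forall>\<^sub>F \<delta> in at_right 0. ereal c \<le> h \<delta>"
    using eventually_at_right_real[OF eps] by (auto elim!: eventually_mono)
  then have "ereal c \<le> top_entropy F"
    using top_entropy_tendsto[OF M, of F] unfolding h_def by (intro tendsto_lowerbound) auto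
  then show ?thesis using \<open>0 < c\<close> by (metis ereal_less(2) less_le_trans)
qed

lemma top_entropy_pos_if_doubling:
  fixes F :: "'a::metric_space \<Rightarrow> 'a set"
  assumes M: "compact (UNIV :: 'a set)" and ne: "\<And>x. F x \<noteq> {}" and eps: "0 < \<epsilon>"
    and good: "\<And>K. good K \<Longrightarrow> K \<noteq> {}" and K: "good K"
    and doubling: "\<And>K. good K \<Longrightarrow> \<exists>m L1 L2. m \<le> N \<and> good L1 \<and> good L2 \<and>
        L1 \<subseteq> (sv_image F ^^ m) K \<and> L2 \<subseteq> (sv_image F ^^ m) K \<and> (\<forall>u\<in>L1. \<forall>v\<in>L2. \<epsilon> < dist u v)"
  shows "0 < top_entropy F"
proof (rule top_entropy_pos_if_exponential[OF M eps])
  fix k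
  from separated_power_two[of F \<epsilon> good N, OF ne eps good doubling K]
  obtain A where "separated F (k * N + 1) \<epsilon> A" "card A = 2 ^ k" by blast
  then show "2 ^ k \<le> max_separated F (k * N + 1) \<epsilon>"
    using max_separated(2)[OF M eps] by metis
qed

section \<open>Stretched continua of an expansive map\<close>

text \<open>The pair cannot be found in a small continuum inside \<open>K\<close>, because \<open>\<rho>\<close> may vanish on all small
  subcontinua (when \<open>K\<close> is hereditarily indecomposable, say).  Instead, the function \<open>\<rho> a\<close> takes on \<open>K\<close> the values \<open>j \<delta> / P\<close> for \<open>j = 0, \<dots>, P\<close>, and if \<open>P\<close> balls of radius
  \<open>\<eta> / 2\<close> cover the space, two of the points realising these values lie in the same ball.\<close>

lemma close_pair_in_connected:
  fixes \<rho> :: "'a::metric_space \<Rightarrow> 'a \<Rightarrow> real"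
  assumes M: "compact (UNIV :: 'a set)" and eta: "0 < \<eta>" and delta: "0 < \<delta>"
    and cont: "\<And>a. continuous_on UNIV (\<rho> a)" and refl: "\<And>a. \<rho> a a = 0"
    and tri: "\<And>a x y. \<rho> a y \<le> \<rho> a x + \<rho> x y"
  obtains \<gamma> where "0 < \<gamma>"
    "\<And>K a b. connected K \<Longrightarrow> a \<in> K \<Longrightarrow> b \<in> K \<Longrightarrow> \<delta> \<le> \<rho> a b \<Longrightarrow>
       \<exists>x\<in>K. \<exists>y\<in>K. dist x y < \<eta> \<and> \<gamma> \<le> \<rho> x y"
proof -
  have "0 < \<eta>/2" using eta by simp
  then obtain C :: "'a set" where C: "finite C" "UNIV \<subseteq> (\<Union>c\<in>C. ball c (\<eta>/2))"
    using M unfolding compact_eq_totally_bounded by blast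
  then have "\<forall>x. \<exists>c\<in>C. dist c x < \<eta>/2" by (meson UN_E UNIV_I mem_ball subsetD)
  then obtain p where p: "\<And>x. p x \<in> C" "\<And>x. dist (p x) x < \<eta>/2" by metis
  define P where "P = card C"
  have "C \<noteq> {}" using p(1) by blast
  then have P: "0 < P" using C(1) by (simp add: P_def card_gt_0_iff)
  show thesis
  proof (rule that[of "\<delta> / P"])
    show "0 < \<delta> / P" using delta P by simp
    fix K a b assume K: "connected K" "a \<in> K" "b \<in> K" "\<delta> \<le> \<rho> a b"
    have "connected (\<rho> a ` K)"
      using K(1) continuous_on_subset[OF cont] by (intro connected_continuous_image) auto
    then have range: "{0..\<rho> a b} \<subseteq> \<rho> a ` K"
      using imageI[OF K(2), of "\<rho> a"] imageI[OF K(3), of "\<rho> a"]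
      unfolding refl by (rule connected_contains_Icc)
    have "\<exists>z\<in>K. \<rho> a z = j * (\<delta> / P)" if "j \<in> {0..P}" for j
    proof -
      have "real j * (\<delta> / P) \<le> P * (\<delta> / P)"
        using that delta by (intro mult_right_mono) auto
      then have "real j * (\<delta> / P) \<in> {0..\<rho> a b}" using K(4) P delta by simp
      then show ?thesis using range by force
    qed
    then obtain z where z: "\<And>j. j \<in> {0..P} \<Longrightarrow> z j \<in> K \<and> \<rho> a (z j) = j * (\<delta> / P)" by metis
    have "card ((p \<circ> z) ` {0..P}) \<le> P"
      using p(1) C(1) unfolding P_def by (intro card_mono) auto
    then have "\<not> inj_on (p \<circ> z) {0..P}"
      by (intro pigeonhole) simp
    then obtain i j where ij: "i \<in> {0..P}" "j \<in> {0..P}" "i < j" "p (z i) = p (z j)"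
      unfolding inj_on_def by (metis comp_apply linorder_neqE_nat)
    have "dist (z i) (z j) < \<eta>"
      using p(2)[of "z i"] p(2)[of "z j"] dist_triangle3[of "z i" "z j" "p (z i)"] ij(4) by simp
    moreover have "1 * (\<delta> / P) \<le> (real j - real i) * (\<delta> / P)"
      using ij delta by (intro mult_right_mono) auto
    then have "\<delta> / P \<le> \<rho> (z i) (z j)"
      using tri[where a = a and x = "z i" and y = "z j"] z[OF ij(1)] z[OF ij(2)]
      unfolding left_diff_distrib by linarith
    ultimately show "\<exists>x\<in>K. \<exists>y\<in>K. dist x y < \<eta> \<and> \<delta> / P \<le> \<rho> x y"
      using z ij by blast
  qed
qed

text \<open>The alternative \<open>F\<^sup>n(x) = F\<^sup>n(y)\<close> for all \<open>n \<ge> 1\<close> in positive expansivity amounts to \<open>F x = F y\<close>,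
  so all other pairs are separated at some time.\<close>

locale expansive_sv_map =
  fixes F :: "'a::metric_space \<Rightarrow> 'a set" and \<alpha> :: real
  assumes compact_space: "compact (UNIV :: 'a set)"
    and sv_map: "set_valued_map F" and cont: "sv_continuous F" and alpha: "0 < \<alpha>"
    and expansive: "F x \<noteq> F y \<Longrightarrow>
      \<exists>n. \<alpha> < hausdorff_dist ((sv_image F ^^ n) {x}) ((sv_image F ^^ n) {y})"
begin

abbreviation \<rho> :: "'a \<Rightarrow> 'a \<Rightarrow> real" where
  "\<rho> x y \<equiv> hausdorff_dist (F x) (F y)"

text \<open>Size is measured after applying \<open>F\<close>: for \<open>\<delta> > 0\<close> a continuum on which \<open>F\<close> is constant is not
  stretched, however large it is.\<close>

definition stretched :: "real \<Rightarrow> 'a set \<Rightarrow> bool" where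
  "stretched \<delta> K \<longleftrightarrow> compact K \<and> connected K \<and> (\<exists>a\<in>K. \<exists>b\<in>K. \<delta> \<le> \<rho> a b)"

lemma image_in_nonempty_compacts: "F x \<in> nonempty_compacts"
  by (rule set_valued_map_nonempty_compacts[OF compact_space sv_map])

lemma iterate:
  shows "sv_continuous (\<lambda>x. (sv_image F ^^ n) {x})" "set_valued_map (\<lambda>x. (sv_image F ^^ n) {x})"
    and "(sv_image F ^^ n) {x} \<in> nonempty_compacts"
  using iterate_set_valued_continuous[OF compact_space cont sv_map, of n]
    set_valued_map_nonempty_compacts[OF compact_space] by auto

lemma rho_refl: "\<rho> x x = 0"
  using image_in_nonempty_compacts by simp

lemma rho_triangle: "\<rho> x z \<le> \<rho> x y + \<rho> y z"
  by (rule hyperspace.triangle[OF image_in_nonempty_compacts image_in_nonempty_compacts image_in_nonempty_compacts])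

lemma continuous_rho: "continuous_on UNIV (\<lambda>p. \<rho> (fst p) (snd p))" "continuous_on UNIV (\<rho> a)"
proof -
  show *: "continuous_on UNIV (\<lambda>p. \<rho> (fst p) (snd p))"
    by (rule continuous_on_hausdorff_dist[OF compact_space cont sv_map])
  show "continuous_on UNIV (\<rho> a)"
    using continuous_on_compose2[OF *, of UNIV "\<lambda>x. (a, x)"] by (simp add: continuous_on_Pair)
qed

lemma rho_uniformly_small:
  assumes "0 < e"
  obtains \<eta> where "0 < \<eta>" "\<And>x y. dist x y < \<eta> \<Longrightarrow> \<rho> x y < e"
proof -
  have "compact (UNIV :: ('a \<times> 'a) set)"
    using compact_Times[OF compact_space compact_space] by (simp add: UNIV_Times_UNIV)
  then have "uniformly_continuous_on UNIV (\<lambda>p. \<rho> (fst p) (snd p))"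
    by (rule compact_uniformly_continuous[OF continuous_rho(1)])
  then obtain \<eta> where eta: "0 < \<eta>"
      "\<And>p q. dist p q < \<eta> \<Longrightarrow> dist (\<rho> (fst p) (snd p)) (\<rho> (fst q) (snd q)) < e"
    using assms unfolding uniformly_continuous_on_def by (metis UNIV_I)
  have "\<rho> x y < e" if "dist x y < \<eta>" for x y
    using eta(2)[of "(x, x)" "(x, y)"] that rho_refl[of x] by (simp add: dist_Pair_Pair dist_real_def)
  then show thesis using that eta(1) by blast
qed

text \<open>At time 0 the images are the points \<open>x\<close> and \<open>y\<close> themselves.  A positive time is needed because
  \<open>continuum_of_large_image_spread\<close> goes back by one step.\<close>

lemma expansive_positive_time:
  assumes "dist x y \<le> \<alpha>" "F x \<noteq> F y"
  obtains n where "\<alpha> < hausdorff_dist ((sv_image F ^^ Suc n) {x}) ((sv_image F ^^ Suc n) {y})"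
proof -
  obtain n where n: "\<alpha> < hausdorff_dist ((sv_image F ^^ n) {x}) ((sv_image F ^^ n) {y})"
    using expansive[OF assms(2)] by blast
  have "hausdorff_dist {x} {y} = dist x y"
    by (simp add: hausdorff_dist_def infdist_def dist_commute)
  then have "n \<noteq> 0"
    using n assms(1) by (intro notI) simp
  then obtain j where "n = Suc j" by (cases n) auto
  then show thesis using n that by blast
qed

text \<open>The pairs \<open>(x, y)\<close> with \<open>dist x y \<le> \<alpha>\<close> and \<open>\<rho> x y \<ge> \<gamma>\<close> form a compact set, which is covered by the
  open sets of pairs that are separated at a given time; finitely many times suffice.\<close>

lemma uniform_separation_time:
  assumes delta: "0 < \<delta>"
  obtains N where "\<And>K. stretched \<delta> K \<Longrightarrow> \<exists>x\<in>K. \<exists>y\<in>K. \<exists>n<N.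
    \<alpha> < hausdorff_dist ((sv_image F ^^ Suc n) {x}) ((sv_image F ^^ Suc n) {y})"
proof -
  let ?D = "\<lambda>n p. hausdorff_dist ((sv_image F ^^ Suc n) {fst p}) ((sv_image F ^^ Suc n) {snd p})"
  obtain \<gamma> where gamma: "0 < \<gamma>"
    "\<And>K a b. connected K \<Longrightarrow> a \<in> K \<Longrightarrow> b \<in> K \<Longrightarrow> \<delta> \<le> \<rho> a b \<Longrightarrow> \<exists>x\<in>K. \<exists>y\<in>K. dist x y < \<alpha> \<and> \<gamma> \<le> \<rho> x y"
    using close_pair_in_connected[of \<alpha> \<delta> \<rho>] compact_space alpha delta continuous_rho(2) rho_refl rho_triangle
    by blast
  let ?Q = "{p. dist (fst p) (snd p) \<le> \<alpha>} \<inter> {p. \<gamma> \<le> \<rho> (fst p) (snd p)} :: ('a \<times> 'a) set"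
  have "compact (UNIV :: ('a \<times> 'a) set)"
    using compact_Times[OF compact_space compact_space] by (simp add: UNIV_Times_UNIV)
  moreover have "closed ?Q"
    by (intro closed_Int closed_Collect_le continuous_intros continuous_rho(1))
  ultimately have Q: "compact ?Q"
    using compact_Int_closed by fastforce
  have op: "open {p. \<alpha> < ?D n p}" for n
    by (intro open_Collect_less continuous_on_const continuous_on_hausdorff_dist[OF compact_space iterate(1,2)])
  have "?Q \<subseteq> (\<Union>n\<in>UNIV. {p. \<alpha> < ?D n p})"
  proof
    fix p assume "p \<in> ?Q"
    then have p: "dist (fst p) (snd p) \<le> \<alpha>" "\<gamma> \<le> \<rho> (fst p) (snd p)" by auto
    then have "F (fst p) \<noteq> F (snd p)" using gamma(1) rho_refl[of "snd p"] by auto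
    then obtain n where "\<alpha> < ?D n p" using expansive_positive_time[OF p(1)] by blast
    then show "p \<in> (\<Union>n\<in>UNIV. {p. \<alpha> < ?D n p})" by blast
  qed
  then obtain I where "I \<subseteq> UNIV" and I: "finite I" "?Q \<subseteq> (\<Union>n\<in>I. {p. \<alpha> < ?D n p})"
    by (rule compactE_image[OF Q op])
  define N where "N = Suc (Max I)"
  have N: "n < N" if "n \<in> I" for n
    using Max_ge[OF I(1) that] by (simp add: N_def)
  show thesis
  proof (rule that)
    fix K assume "stretched \<delta> K"
    then obtain x y where xy: "x \<in> K" "y \<in> K" "dist x y < \<alpha>" "\<gamma> \<le> \<rho> x y"
      using gamma(2) unfolding stretched_def by metis
    then have "(x, y) \<in> ?Q" by simp
    then obtain n where "n \<in> I" "\<alpha> < ?D n (x, y)" using I(2) by blast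
    then show "\<exists>x\<in>K. \<exists>y\<in>K. \<exists>n<N.
        \<alpha> < hausdorff_dist ((sv_image F ^^ Suc n) {x}) ((sv_image F ^^ Suc n) {y})"
      using xy N[of n] by auto
  qed
qed

text \<open>Separation of \<open>F\<^sup>n\<^sup>+\<^sup>1 x\<close> from \<open>F\<^sup>n\<^sup>+\<^sup>1 y\<close> is witnessed by a point \<open>u\<close> of one of these sets that is far
  from the \<^emph>\<open>whole\<close> other set.  A predecessor \<open>w\<close> of \<open>u\<close> in \<open>F\<^sup>n x\<close> therefore has \<open>\<rho> w w' > \<alpha>\<close>
  for all \<open>w'\<close> in \<open>F\<^sup>n y\<close>, and it does not matter which \<open>w'\<close> the lifted continuum provides.\<close>

lemma continuum_of_large_image_spread:
  assumes K: "compact K" "connected K" "x \<in> K" "y \<in> K"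
    and far: "\<alpha> < hausdorff_dist ((sv_image F ^^ Suc n) {x}) ((sv_image F ^^ Suc n) {y})"
  obtains L w w' where "compact L" "connected L" "L \<subseteq> (sv_image F ^^ n) K" "w \<in> L" "w' \<in> L" "\<alpha> < \<rho> w w'"
proof -
  note result = that
  let ?G = "\<lambda>x. (sv_image F ^^ n) {x}" and ?H = "\<lambda>x. (sv_image F ^^ Suc n) {x}"
  have H: "?H z \<noteq> {}" "bounded (?H z)" for z
    using iterate(3)[of "Suc n" z] by (auto simp: nonempty_compacts_def compact_imp_bounded)
  have step: "?H z = (\<Union>w\<in>?G z. F w)" for z by (simp add: sv_image_def[of F "?G z"])
  have one_side: thesis if xy: "x \<in> K" "y \<in> K" "u \<in> ?H x" "\<alpha> < infdist u (?H y)" for x y u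
  proof -
    obtain w where w: "w \<in> ?G x" "u \<in> F w" using xy(3) step by blast
    obtain L w' where L: "compact L" "connected L" "L \<subseteq> sv_image ?G K" "w \<in> L" "w' \<in> L" "w' \<in> ?G y"
      using continuum_lifting[OF iterate(1) compact_sv_image(1)[OF compact_space iterate(1,2) K(1)] K(2) xy(1) w(1) xy(2)]
      by blast
    have F: "F z \<noteq> {}" "bounded (F z)" for z
      using image_in_nonempty_compacts[of z] by (auto simp: nonempty_compacts_def compact_imp_bounded)
    have "infdist u (?H y) \<le> infdist u (F w')"
      using L(6) F step by (intro infdist_mono) auto
    also have "\<dots> \<le> \<rho> w w'"
      using infdist_le_hausdorff_dist F w(2) by metis
    finally have "\<alpha> < \<rho> w w'" using xy(4) by linarith
    then show thesis using result[OF L(1,2) _ L(4,5)] L(3) unfolding sv_image_iterate by blast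
  qed
  have "\<not> ((\<forall>u\<in>?H x. infdist u (?H y) \<le> \<alpha>) \<and> (\<forall>u\<in>?H y. infdist u (?H x) \<le> \<alpha>))"
    using hausdorff_dist_le[of "?H x" "?H y" \<alpha>] H far by force
  then show thesis using one_side K by (meson not_le)
qed

text \<open>The pieces are the components of \<open>w\<close> and of \<open>w'\<close> in the closed \<open>\<rho>\<close>-balls of radius \<open>\<alpha>/4\<close> within \<open>L\<close>.
  They reach the boundaries of these balls, and points of different pieces have \<open>\<rho>\<close> at least
  \<open>\<alpha>/2\<close>, hence a definite distance.\<close>

lemma two_stretched_pieces:
  assumes delta: "0 < \<delta>" "\<delta> \<le> \<alpha>/4"
  obtains \<epsilon> where "0 < \<epsilon>"
    "\<And>L w w'. compact L \<Longrightarrow> connected L \<Longrightarrow> w \<in> L \<Longrightarrow> w' \<in> L \<Longrightarrow> \<alpha> < \<rho> w w' \<Longrightarrow>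
       \<exists>L1 L2. stretched \<delta> L1 \<and> stretched \<delta> L2 \<and> L1 \<subseteq> L \<and> L2 \<subseteq> L \<and> (\<forall>u\<in>L1. \<forall>v\<in>L2. \<epsilon> < dist u v)"
proof -
  obtain \<eta> where eta: "0 < \<eta>" "\<And>x y. dist x y < \<eta> \<Longrightarrow> \<rho> x y < \<alpha>/2"
    using rho_uniformly_small[of "\<alpha>/2"] alpha by auto
  have piece: "\<exists>L'. stretched \<delta> L' \<and> L' \<subseteq> L \<and> (\<forall>u\<in>L'. \<rho> w u \<le> \<alpha>/4)"
    if L: "compact L" "connected L" "w \<in> L" "w' \<in> L" "\<alpha> < \<rho> w w'" for L w w'
  proof -
    have "\<rho> w w \<le> \<alpha>/4" "\<alpha>/4 \<le> \<rho> w w'" using alpha L(5) rho_refl[of w] by auto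
    then obtain C z where "compact C" "connected C" "w \<in> C" "C \<subseteq> L" "\<And>u. u \<in> C \<Longrightarrow> \<rho> w u \<le> \<alpha>/4" "z \<in> C" "\<rho> w z = \<alpha>/4"
      using boundary_bumping_level[OF L(1,2) continuous_rho(2) L(3,4)] by metis
    then show ?thesis
      using delta(2) unfolding stretched_def by (intro exI[of _ C]) force
  qed
  show thesis
  proof (rule that[of "\<eta>/2"])
    show "0 < \<eta>/2" using eta by simp
    fix L w w' assume L: "compact L" "connected L" "w \<in> L" "w' \<in> L" "\<alpha> < \<rho> w w'"
    obtain L1 where L1: "stretched \<delta> L1" "L1 \<subseteq> L" "\<forall>u\<in>L1. \<rho> w u \<le> \<alpha>/4"
      using piece[OF L] by blast
    have "\<alpha> < \<rho> w' w" using L(5) by (simp add: hausdorff_dist_commute)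
    then obtain L2 where L2: "stretched \<delta> L2" "L2 \<subseteq> L" "\<forall>u\<in>L2. \<rho> w' u \<le> \<alpha>/4"
      using piece L by blast
    have "\<eta>/2 < dist u v" if "u \<in> L1" "v \<in> L2" for u v
    proof (rule ccontr)
      assume "\<not> \<eta>/2 < dist u v"
      then have "\<rho> u v < \<alpha>/2" using eta by (intro eta(2)) simp
      moreover have "\<rho> w u \<le> \<alpha>/4" "\<rho> w' v \<le> \<alpha>/4" using that L1(3) L2(3) by auto
      ultimately show False
        using L(5) hausdorff_dist_commute[of "F v" "F w'"]
          rho_triangle[where x = w and y = u and z = w'] rho_triangle[where x = u and y = v and z = w']
        by linarith
    qed
    then show "\<exists>L1 L2. stretched \<delta> L1 \<and> stretched \<delta> L2 \<and> L1 \<subseteq> L \<and> L2 \<subseteq> L \<and> (\<forall>u\<in>L1. \<forall>v\<in>L2. \<eta>/2 < dist u v)"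
      using L1 L2 by blast
  qed
qed

theorem top_entropy_pos_if_nonconstant:
  assumes conn: "connected (UNIV :: 'a set)" and ab: "F a \<noteq> F b"
  shows "0 < top_entropy F"
proof -
  have "0 < \<rho> a b"
    using ab image_in_nonempty_compacts hyperspace.mdist_pos_less by blast
  define \<delta> where "\<delta> = min (\<alpha>/4) (\<rho> a b)"
  have delta: "0 < \<delta>" "\<delta> \<le> \<alpha>/4" "\<delta> \<le> \<rho> a b"
    using alpha \<open>0 < \<rho> a b\<close> by (auto simp: \<delta>_def)
  obtain N where N: "\<And>K. stretched \<delta> K \<Longrightarrow> \<exists>x\<in>K. \<exists>y\<in>K. \<exists>n<N.
      \<alpha> < hausdorff_dist ((sv_image F ^^ Suc n) {x}) ((sv_image F ^^ Suc n) {y})"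
    using uniform_separation_time[OF delta(1)] by blast
  obtain \<epsilon> where eps: "0 < \<epsilon>"
    "\<And>L w w'. compact L \<Longrightarrow> connected L \<Longrightarrow> w \<in> L \<Longrightarrow> w' \<in> L \<Longrightarrow> \<alpha> < \<rho> w w' \<Longrightarrow>
       \<exists>L1 L2. stretched \<delta> L1 \<and> stretched \<delta> L2 \<and> L1 \<subseteq> L \<and> L2 \<subseteq> L \<and> (\<forall>u\<in>L1. \<forall>v\<in>L2. \<epsilon> < dist u v)"
    using two_stretched_pieces[OF delta(1,2)] by blast
  show ?thesis
  proof (rule top_entropy_pos_if_doubling[OF compact_space _ eps(1), where good = "stretched \<delta>" and N = N])
    show "F x \<noteq> {}" for x using sv_map by (simp add: set_valued_map_def)
    show "stretched \<delta> UNIV" using compact_space conn delta(3) by (auto simp: stretched_def)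
    show "K \<noteq> {}" if "stretched \<delta> K" for K using that by (auto simp: stretched_def)
    fix K assume K: "stretched \<delta> K"
    then obtain x y n where xy: "x \<in> K" "y \<in> K" "n < N"
      "\<alpha> < hausdorff_dist ((sv_image F ^^ Suc n) {x}) ((sv_image F ^^ Suc n) {y})"
      using N by blast
    have "compact K" "connected K" using K by (auto simp: stretched_def)
    then obtain L w w' where L: "compact L" "connected L" "L \<subseteq> (sv_image F ^^ n) K" "w \<in> L" "w' \<in> L" "\<alpha> < \<rho> w w'"
      using continuum_of_large_image_spread xy by metis
    obtain L1 L2 where "stretched \<delta> L1" "stretched \<delta> L2" "L1 \<subseteq> L" "L2 \<subseteq> L" "\<forall>u\<in>L1. \<forall>v\<in>L2. \<epsilon> < dist u v"
      using eps(2)[OF L(1,2,4,5,6)] by blast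
    then show "\<exists>m L1 L2. m \<le> N \<and> stretched \<delta> L1 \<and> stretched \<delta> L2 \<and> L1 \<subseteq> (sv_image F ^^ m) K \<and>
        L2 \<subseteq> (sv_image F ^^ m) K \<and> (\<forall>u\<in>L1. \<forall>v\<in>L2. \<epsilon> < dist u v)"
      using L(3) xy(3) by (intro exI[of _ n] exI[of _ L1] exI[of _ L2]) auto
  qed
qed

end

section \<open>Positive entropy\<close>

text \<open>Every word in the letters \<open>a\<close> and \<open>b\<close> is an orbit segment.\<close>

lemma top_entropy_pos_if_constant_UNIV:
  fixes F :: "'a::metric_space \<Rightarrow> 'a set"
  assumes M: "compact (UNIV :: 'a set)" and F: "\<And>x. F x = UNIV" and ab: "(a :: 'a) \<noteq> b"
  shows "0 < top_entropy F"
proof (rule top_entropy_pos_if_doubling[OF M, where good = "\<lambda>K. K = {a} \<or> K = {b}" and N = 1 and \<epsilon> = "dist a b / 2" and K = "{a}"])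
  fix K assume "K = {a} \<or> K = {b}"
  then have "(sv_image F ^^ 1) K = UNIV" using F by (auto simp: sv_image_def)
  then show "\<exists>m L1 L2. m \<le> 1 \<and> (L1 = {a} \<or> L1 = {b}) \<and> (L2 = {a} \<or> L2 = {b}) \<and>
      L1 \<subseteq> (sv_image F ^^ m) K \<and> L2 \<subseteq> (sv_image F ^^ m) K \<and> (\<forall>u\<in>L1. \<forall>v\<in>L2. dist a b / 2 < dist u v)"
    using ab by (intro exI[of _ 1] exI[of _ "{a}"] exI[of _ "{b}"]) simp
qed (use ab F in auto)

text \<open>If \<open>x\<close> were the only point, a chart would map it to an open point of Euclidean space, which would be
  clopen; but Euclidean space of positive dimension is connected and has more than one point.\<close>

lemma manifold_two_points:
  assumes M: "topological_manifold d X" and d: "0 < d" and x: "x \<in> topspace X"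
  shows "\<exists>y\<in>topspace X. y \<noteq> x"
proof (rule ccontr)
  let ?E = "Euclidean_space d"
  assume "\<not> ?thesis"
  then have X: "topspace X = {x}" using x by blast
  obtain U V where U: "openin X U" "x \<in> U" and V: "openin ?E V"
    and hom: "subtopology X U homeomorphic_space subtopology ?E V"
    using M x unfolding topological_manifold_def by blast
  have "U = {x}" using openin_subset[OF U(1)] U(2) X by auto
  moreover have "topspace (subtopology ?E V) = V" using openin_subset[OF V] by auto
  moreover obtain f where "homeomorphic_map (subtopology X U) (subtopology ?E V) f"
    using hom unfolding homeomorphic_space by blast
  then have "f ` topspace (subtopology X U) = topspace (subtopology ?E V)"
    by (rule homeomorphic_imp_surjective_map)
  ultimately have "V = {f x}" using X by auto
  then obtain v where v: "V = {v}" by blast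
  have "closedin ?E V"
    using V openin_subset[OF V] Hausdorff_Euclidean_space[of d] unfolding v
    by (simp add: closedin_Hausdorff_singleton)
  then have "V = topspace ?E"
    using connected_Euclidean_space[of d] V v unfolding connected_space_clopen_in by blast
  then have "\<And>p. p \<in> topspace ?E \<Longrightarrow> p = v" using v by blast
  moreover have "(\<lambda>i. 0) \<in> topspace ?E" "(\<lambda>i. if i = 0 then 1 else 0) \<in> topspace ?E"
    using d by (auto simp: topspace_Euclidean_space)
  ultimately have "(\<lambda>i. 0 :: real) = (\<lambda>i. if i = (0::nat) then 1 else 0)" by metis
  then have "(0 :: real) = 1" by (metis (full_types))
  then show False by simp
qed

theorem theorem2:
  fixes F :: "'a::metric_space \<Rightarrow> 'a set" and d :: nat
  assumes "compact (UNIV :: 'a set)"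
    and "connected (UNIV :: 'a set)"
    and "topological_manifold d (euclidean :: 'a topology)"
    and "d > 0"
    and "set_valued_map F"
    and "sv_continuous F"
    and "positively_expansive F"
    and "closedin hyperspace (iterate_family F)"
  shows "top_entropy F > 0"
proof (cases "\<exists>a b. F a \<noteq> F b")
  case True
  obtain \<alpha> where alpha: "0 < \<alpha>" "\<And>x y. x \<noteq> y \<Longrightarrow>
      (\<exists>n. hausdorff_dist ((sv_image F ^^ n) {x}) ((sv_image F ^^ n) {y}) > \<alpha>) \<or>
      (\<forall>n\<ge>1. (sv_image F ^^ n) {x} = (sv_image F ^^ n) {y})"
    using \<open>positively_expansive F\<close> unfolding positively_expansive_def by (auto simp: sv_iter_def)
  have "(sv_image F ^^ 1) {x} = F x" for x by (simp add: sv_image_def)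
  then have "\<exists>n. \<alpha> < hausdorff_dist ((sv_image F ^^ n) {x}) ((sv_image F ^^ n) {y})" if "F x \<noteq> F y" for x y
    using alpha(2)[of x y] that by (metis order_refl)
  then interpret expansive_sv_map F \<alpha>
    using assms alpha(1) by unfold_locales
  show ?thesis using True top_entropy_pos_if_nonconstant assms(2) by blast
next
  case False
  have "sv_image F UNIV = UNIV"
    using \<open>positively_expansive F\<close> by (simp add: positively_expansive_def sv_surjective_def)
  then have "F x = UNIV" for x
    using False unfolding sv_image_def by (metis UNIV_I UNIV_eq_I UN_E)
  moreover obtain a b :: 'a where "a \<noteq> b"
    using manifold_two_points[OF assms(3,4), of undefined] by auto
  ultimately show ?thesis
    using top_entropy_pos_if_constant_UNIV[OF assms(1)] by blast
qed

end
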